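(* Let $g$ lie in $\mathcal{C}^0\cap\mathcal{D}^p\cap\mathcal{K}^p$ for some $p\in\mathbb{N}$. Let $\tilde g\colon\mathbb{R}_+\to\mathbb{R}$ be the function defined by $\tilde g(x)=2\,g(2x)$ for $x>0$. Let also $h\colon\mathbb{N}^*\to\mathbb{R}$ be the sequence defined by $$h(n)=\sigma[\tilde g]-\sigma[g]+\int_1^2(g(2n+t)-g(t))\,dt+\sum_{j=1}^pG_j\left(\Delta^{j-1}g(2n+1)-\Delta^{j-1}\tilde g(n+1)\right)\qquad\text{for }n\in\mathbb{N}^*.$$ Then $$\lim_{n\to\infty}\left(h(n)+\sum_{k=1}^{2n}(-1)^{k-1}g(k)\right)=0.$$
   Context: $\mathbb{N}=\{0,1,2,\ldots\}$, $\mathbb{N}^*=\{1,2,\ldots\}$, $\mathbb{R}_+=(0,\infty)$, $\Delta f(x)=f(x+1)-f(x)$; $\mathcal{C}^0$ is the set of continuous functions $\mathbb{R}_+\to\mathbb{R}$. For an integer $p\ge -1$, a function $f\colon I\to\mathbb{R}$ on a real interval $I$ is $p$-convex (resp. $p$-concave) if for all $x_0<\cdots<x_{p+1}$ in $I$ the divided difference $f[x_0,\ldots,x_{p+1}]$ is $\ge 0$ (resp. $\le 0$), where $f[x_0,\ldots,x_n]=\sum_{k=0}^n f(x_k)/\prod_{j\ne k}(x_k-x_j)$. $\mathcal{K}^p$ is the set of functions $\mathbb{R}_+\to\mathbb{R}$ that are $p$-convex on some $[a,\infty)$ or $p$-concave on some $[a,\infty)$. $\mathcal{D}^p$ is the set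 of $g\colon\mathbb{R}_+\to\mathbb{R}$ with $\Delta^pg(n)\to 0$ as $n\to\infty$ over the integers. For $g\in\mathcal{D}^p\cap\mathcal{K}^p$, the function $\Sigma g\colon\mathbb{R}_+\to\mathbb{R}$ is $$\Sigma g(x)=\lim_{n\to\infty}\Big(-g(x)+\sum_{k=1}^{n-1}(g(k)-g(x+k))+\sum_{j=1}^p\binom{x}{j}\Delta^{j-1}g(n)\Big);$$ the limit exists, does not depend on the choice of such $p$, and $\Sigma g$ is the unique solution $f\in\mathcal{K}^p$ of $\Delta f=g$ with $f(1)=0$; it is continuous if $g$ is. $\sigma[g]=\int_0^1\Sigma g(t+1)\,dt$, and $G_n=\int_0^1\binom{t}{n}\,dt$. (Under the hypotheses $\tilde g$ also lies in $\mathcal{C}^0\cap\mathcal{D}^p\cap\mathcal{K}^p$.) *)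

theory Defs
  imports "HOL-Analysis.Analysis"
begin

text \<open>
  A function on the open half-line of positive reals is represented by a total function of type
  \<^typ>\<open>real \<Rightarrow> real\<close>; only its values at positive arguments matter below.
\<close>

definition fdiff :: "(real \<Rightarrow> real) \<Rightarrow> real \<Rightarrow> real" where
  "fdiff f x = f (x + 1) - f x"

definition divided_difference :: "(real \<Rightarrow> real) \<Rightarrow> (nat \<Rightarrow> real) \<Rightarrow> nat \<Rightarrow> real" where
  "divided_difference f x n = (\<Sum>k\<le>n. f (x k) / (\<Prod>j\<in>{..n} - {k}. x k - x j))"

definition p_convex_on :: "nat \<Rightarrow> real set \<Rightarrow> (real \<Rightarrow> real) \<Rightarrow> bool" where
  "p_convex_on p I f \<longleftrightarrow>
     (\<forall>x. strict_mono_on {..p + 1} x \<and> x ` {..p + 1} \<subseteq> I \<longrightarrow> divided_difference f x (p + 1) \<ge> 0)"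

definition p_concave_on :: "nat \<Rightarrow> real set \<Rightarrow> (real \<Rightarrow> real) \<Rightarrow> bool" where
  "p_concave_on p I f \<longleftrightarrow>
     (\<forall>x. strict_mono_on {..p + 1} x \<and> x ` {..p + 1} \<subseteq> I \<longrightarrow> divided_difference f x (p + 1) \<le> 0)"

definition C0_space :: "(real \<Rightarrow> real) set" where
  "C0_space = {f. continuous_on {0<..} f}"

definition K_space :: "nat \<Rightarrow> (real \<Rightarrow> real) set" where
  "K_space p = {f. \<exists>a>0. p_convex_on p {a..} f \<or> p_concave_on p {a..} f}"

definition D_space :: "nat \<Rightarrow> (real \<Rightarrow> real) set" where
  "D_space p = {g. (\<lambda>n. (fdiff ^^ p) g (real n)) \<longlonglongrightarrow> 0}"

definition Sigma_seq :: "nat \<Rightarrow> (real \<Rightarrow> real) \<Rightarrow> real \<Rightarrow> nat \<Rightarrow> real" where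
  "Sigma_seq p g x n =
     - g x + (\<Sum>k=1..<n. g (real k) - g (x + real k))
       + (\<Sum>j=1..p. (x gchoose j) * (fdiff ^^ (j - 1)) g (real n))"

text \<open>
  The exponent is an arbitrary admissible one; lemma \<open>Sigma_eq\<close> shows that its choice is immaterial.
\<close>
definition Sigma_op :: "(real \<Rightarrow> real) \<Rightarrow> real \<Rightarrow> real" where
  "Sigma_op g x = lim (Sigma_seq (SOME p. g \<in> D_space p \<inter> K_space p) g x)"

definition sigma_const :: "(real \<Rightarrow> real) \<Rightarrow> real" where
  "sigma_const g = integral {0..1} (\<lambda>t. Sigma_op g (t + 1))"

definition gregory_coeff :: "nat \<Rightarrow> real" where
  "gregory_coeff n = integral {0..1} (\<lambda>t. t gchoose n)"

lemma D_space_Suc: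
  assumes "g \<in> D_space p"
  shows "g \<in> D_space (Suc p)"
proof -
  have 1: "(\<lambda>n. (fdiff ^^ p) g (real n)) \<longlonglongrightarrow> 0"
    using assms by (simp add: D_space_def)
  have 2: "(\<lambda>n. (fdiff ^^ p) g (real (Suc n))) \<longlonglongrightarrow> 0"
    using LIMSEQ_Suc[OF 1] .
  show ?thesis
    using tendsto_diff[OF 2 1] by (simp add: D_space_def fdiff_def add.commute)
qed

lemma D_space_mono:
  assumes "p \<le> q" "g \<in> D_space p"
  shows "g \<in> D_space q"
  using assms by (induction q rule: dec_induct) (auto intro: D_space_Suc)

lemma Sigma_seq_diff_tendsto:
  assumes "p \<le> q" "g \<in> D_space p"
  shows "(\<lambda>n. Sigma_seq q g x n - Sigma_seq p g x n) \<longlonglongrightarrow> 0"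
  using assms(1)
proof (induction q rule: dec_induct)
  case base
  show ?case by simp
next
  case (step q)
  have "(\<lambda>n. (fdiff ^^ q) g (real n)) \<longlonglongrightarrow> 0"
    using D_space_mono[OF step(1) assms(2)] by (simp add: D_space_def)
  from tendsto_add[OF step.IH tendsto_mult_left[OF this, of "x gchoose Suc q"]]
  show ?case by (simp add: Sigma_seq_def algebra_simps)
qed

lemma lim_eq_if_diff_tendsto_0:
  fixes X Y :: "nat \<Rightarrow> real"
  assumes "(\<lambda>n. X n - Y n) \<longlonglongrightarrow> 0"
  shows "lim X = lim Y"
proof -
  have "X \<longlonglongrightarrow> L \<longleftrightarrow> Y \<longlonglongrightarrow> L" for L
    using tendsto_diff[of X L sequentially, OF _ assms] tendsto_add[of Y L sequentially, OF _ assms]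
    by auto
  then show ?thesis by (simp add: lim_def)
qed

lemma Sigma_eq:
  assumes "g \<in> D_space p \<inter> K_space p"
  shows "Sigma_op g x = lim (Sigma_seq p g x)"
proof -
  define q where "q = (SOME p. g \<in> D_space p \<inter> K_space p)"
  have q: "g \<in> D_space q \<inter> K_space q"
    unfolding q_def using assms by (rule someI)
  have "lim (Sigma_seq q g x) = lim (Sigma_seq p g x)"
  proof (cases "p \<le> q")
    case True
    then show ?thesis
      using assms by (intro lim_eq_if_diff_tendsto_0 Sigma_seq_diff_tendsto) auto
  next
    case False
    then have "lim (Sigma_seq p g x) = lim (Sigma_seq q g x)"
      using q by (intro lim_eq_if_diff_tendsto_0 Sigma_seq_diff_tendsto) auto
    then show ?thesis by simp
  qed
  then show ?thesis by (simp add: Sigma_op_def q_def)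
qed

end

theory Submission imports Defs begin

text \<open>
  Write \<open>S f m\<close> for the defect in the generalized Stirling formula at the integer \<open>m\<close>,
  namely \<open>(\<Sum>k=1..<m. f k) - integral {1..m} f\<close> plus the Gregory correction
  \<open>\<Sum>j=1..p. gregory_coeff j * (fdiff ^^ (j - 1)) f m\<close>.  The whole proof rests on the convergence of
  \<open>S f m\<close> to \<^term>\<open>sigma_const f\<close> (lemma \<open>generalized_stirling\<close>).
  Since \<open>g' k = 2 * g (2 * k)\<close>, the alternating sum up to \<open>2 * n\<close> is the full sum of \<open>g\<close> minus the
  sum of \<open>g'\<close> up to \<open>n\<close>.  Substituting \<open>u = 2 * t\<close> turns the integral of \<open>g'\<close> into one of \<open>g\<close>,
  and after cancellation only two windows of length one are left, which form the integral in \<open>h\<close>.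
  Hence \<open>h n\<close> plus the alternating sum is exactly
  \<open>S g (2 * n + 1) - sigma_const g - (S g' (n + 1) - sigma_const g')\<close>, and both defects converge;
  the dilation \<open>g'\<close> lies in the same function spaces as \<open>g\<close> (lemma \<open>dilation_in_spaces\<close>).

  For the Stirling formula, integrate over the unit interval the sequence defining \<open>Sigma_op\<close>.
  Up to a null sequence, the term of index \<open>n\<close> at \<open>t + 1\<close> is a continuous function
  \<open>shifted_Sigma_seq p g n t\<close> whose integral is \<open>S g n\<close>, and consecutive functions
  differ by the error of Newton's forward interpolation of \<open>g\<close> at \<open>n, \<dots>, n + p\<close>, evaluated at \<open>n + t\<close>.
  So it is enough that these errors have uniformly small tails.

  The error is a divided difference times a polynomial in \<open>t\<close> of known sign, so p-convexity
  determines its sign.  Comparing the interpolants at \<open>n, \<dots>, n + p\<close> and at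
  \<open>n + 1, \<dots>, n + p + 1\<close>, whose errors at \<open>n + t\<close> have opposite signs, bounds each error by their
  difference, and therefore by \<open>\<bar>(fdiff ^^ Suc p) g n\<bar>\<close> (lemma \<open>newton_remainder_bound\<close>).
  Because these differences eventually have a constant sign, the bounds telescope to a difference
  of two values of \<open>(fdiff ^^ p) g\<close>, which tends to zero.
\<close>

section \<open>Newton and Lagrange interpolation at consecutive integers\<close>

lemma fdiff_funpow_Suc: "(fdiff ^^ Suc j) f a = (fdiff ^^ j) f (a + 1) - (fdiff ^^ j) f a"
  by (simp add: fdiff_def)

lemma fdiff_funpow_expand:
  "(fdiff ^^ j) f a = (\<Sum>i\<le>j. (-1) ^ (j + i) * real (j choose i) * f (a + real i))"
proof (induction j arbitrary: a)
  case 0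
  show ?case by simp
next
  case (Suc j)
  have 1: "(\<Sum>i\<le>j. (-1) ^ (j + i) * real (j choose i) * f (a + real i)) =
     (-1) ^ j * f a + (\<Sum>i\<le>j. (-1) ^ (j + Suc i) * real (j choose Suc i) * f (a + real (Suc i)))"
  proof -
    have "(\<Sum>i\<le>j. (-1) ^ (j + i) * real (j choose i) * f (a + real i)) =
      (\<Sum>i\<le>Suc j. (-1) ^ (j + i) * real (j choose i) * f (a + real i))"
      by simp
    also have "\<dots> = (-1) ^ j * f a +
        (\<Sum>i\<le>j. (-1) ^ (j + Suc i) * real (j choose Suc i) * f (a + real (Suc i)))"
      by (subst sum.atMost_Suc_shift) simp
    finally show ?thesis .
  qed
  have "(\<Sum>i\<le>Suc j. (-1) ^ (Suc j + i) * real (Suc j choose i) * f (a + real i)) =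
     (\<Sum>i\<le>j. (-1) ^ (j + i) * real (j choose i) * f (a + real (Suc i))) - (-1) ^ j * f a
     - (\<Sum>i\<le>j. (-1) ^ (j + Suc i) * real (j choose Suc i) * f (a + real (Suc i)))"
    by (subst sum.atMost_Suc_shift) (simp add: algebra_simps sum.distrib sum_subtractf sum_negf)
  also have "\<dots> = (fdiff ^^ j) f (a + 1) - (fdiff ^^ j) f a"
    unfolding Suc.IH 1 by (simp add: algebra_simps)
  finally show ?case by (simp add: fdiff_funpow_Suc del: funpow.simps)
qed

text \<open>
  Divided by its value at \<open>i\<close>, this is the Lagrange basis polynomial of the nodes \<open>0, \<dots>, p\<close> that
  belongs to \<open>i\<close>.
\<close>
definition node_prod :: "nat \<Rightarrow> nat \<Rightarrow> real \<Rightarrow> real" where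
  "node_prod p i r = (\<Prod>k\<in>{..p} - {i}. r - real k)"

lemma node_prod_eq_gbinomial:
  assumes "i \<le> p"
  shows "node_prod p i r =
    fact i * fact (p - i) * (r gchoose i) * ((r - real i - 1) gchoose (p - i))"
proof -
  have "{..p} - {i} = {0..<i} \<union> {Suc i..<Suc p}"
    using assms by auto
  then have "node_prod p i r = (\<Prod>k=0..<i. r - real k) * (\<Prod>k=Suc i..<Suc p. r - real k)"
    unfolding node_prod_def by (simp add: prod.union_disjoint del: prod.op_ivl_Suc)
  also have "(\<Prod>k=Suc i..<Suc p. r - real k) = (\<Prod>k=0..<p - i. r - real i - 1 - real k)"
    using assms by (intro prod.reindex_bij_witness[where i="\<lambda>k. k + Suc i" and j="\<lambda>k. k - Suc i"])
      (auto simp: of_nat_diff)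
  finally show ?thesis
    by (simp only: gbinomial_mult_fact[symmetric] mult_ac)
qed

lemma node_prod_self:
  assumes "i \<le> p"
  shows "node_prod p i (real i) = fact i * fact (p - i) * (-1) ^ (p - i)"
proof -
  have "((-1::real) gchoose (p - i)) = (-1) ^ (p - i)"
    using gbinomial_minus[of "1::real" "p - i"] by (simp add: binomial_gbinomial[symmetric])
  then show ?thesis
    by (simp add: node_prod_eq_gbinomial[OF assms] binomial_gbinomial[symmetric])
qed

text \<open>
  Newton's form suits the operator \<open>Sigma_op\<close> and telescoping, Lagrange's form suits divided
  differences.  They agree because collecting the coefficient of \<open>f (a + i)\<close> in Newton's form
  leaves, by trinomial revision, an alternating partial sum of binomial coefficients, which has a
  closed form.
\<close>
lemma newton_eq_lagrange:
  "(\<Sum>j\<le>p. (r gchoose j) * (fdiff ^^ j) f a) =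
   (\<Sum>i\<le>p. f (a + real i) * (node_prod p i r / node_prod p i (real i)))"
proof -
  have coeff: "(\<Sum>j\<in>{i..p}. (r gchoose j) * ((-1) ^ (j + i) * real (j choose i))) =
      node_prod p i r / node_prod p i (real i)" if "i \<le> p" for i
  proof -
    have "(\<Sum>j\<in>{i..p}. (r gchoose j) * ((-1) ^ (j + i) * real (j choose i))) =
        (\<Sum>m\<le>p - i. (r gchoose i) * (((r - real i) gchoose m) * (-1) ^ m))"
    proof (rule sum.reindex_bij_witness[where i="\<lambda>m. m + i" and j="\<lambda>j. j - i"])
      fix j assume j: "j \<in> {i..p}"
      then have s: "(-1::real) ^ (j + i) = (-1) ^ (j - i)"
        by (simp add: minus_one_power_iff)
      have "(r gchoose j) * real (j choose i) = (r gchoose i) * ((r - real i) gchoose (j - i))"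
        using gbinomial_trinomial_revision[of i j r] j by (simp add: binomial_gbinomial)
      then show "(r gchoose i) * (((r - real i) gchoose (j - i)) * (-1) ^ (j - i)) =
          (r gchoose j) * ((-1) ^ (j + i) * real (j choose i))"
        unfolding s by (simp add: mult_ac)
    qed (use that in auto)
    also have "\<dots> = (r gchoose i) * ((-1) ^ (p - i) * ((r - real i - 1) gchoose (p - i)))"
      by (simp only: sum_distrib_left[symmetric] gbinomial_sum_lower_neg)
    also have "\<dots> = node_prod p i r / node_prod p i (real i)"
      using that
      by (simp add: node_prod_self node_prod_eq_gbinomial[OF that, of r] minus_one_power_iff)
    finally show ?thesis .
  qed
  have "(\<Sum>j\<le>p. (r gchoose j) * (fdiff ^^ j) f a) =
      (\<Sum>j\<le>p. \<Sum>i\<le>j. (r gchoose j) * ((-1) ^ (j + i) * real (j choose i)) * f (a + real i))"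
    by (simp add: fdiff_funpow_expand sum_distrib_left mult_ac)
  also have "\<dots> =
      (\<Sum>i\<le>p. \<Sum>j\<in>{i..p}. (r gchoose j) * ((-1) ^ (j + i) * real (j choose i)) * f (a + real i))"
    unfolding sum.Sigma[OF finite_atMost ballI[OF finite_atMost]]
      sum.Sigma[OF finite_atMost ballI[OF finite_atLeastAtMost]]
    by (rule sum.reindex_bij_witness[where i="\<lambda>(i, j). (j, i)" and j="\<lambda>(i, j). (j, i)"]) auto
  also have "\<dots> = (\<Sum>i\<le>p. f (a + real i) * (node_prod p i r / node_prod p i (real i)))"
    by (intro sum.cong) (simp_all add: coeff sum_distrib_right[symmetric])
  finally show ?thesis .
qed

text \<open>
  The interpolation nodes are \<open>a, a + 1, \<dots>, a + p\<close>; the point \<open>a + r\<close> is given by its offset.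
\<close>
definition newton_remainder :: "nat \<Rightarrow> (real \<Rightarrow> real) \<Rightarrow> real \<Rightarrow> real \<Rightarrow> real" where
  "newton_remainder p f a r = f (a + r) - (\<Sum>j\<le>p. (r gchoose j) * (fdiff ^^ j) f a)"

lemma newton_remainder_node:
  assumes "m \<le> p"
  shows "newton_remainder p f a (real m) = 0"
proof -
  have "f (a + real i) * (node_prod p i (real m) / node_prod p i (real i)) =
      (if i = m then f (a + real i) else 0)" if "i \<le> p" for i
    using assms that node_prod_self[OF that] by (auto simp: node_prod_def)
  then show ?thesis
    using assms by (simp add: newton_remainder_def newton_eq_lagrange)
qed

section \<open>Convexity bounds for the interpolation error\<close>

text \<open>
  With \<open>s = 1\<close> this is p-convexity and with \<open>s = -1\<close> p-concavity, so that both cases of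
  \<^const>\<open>K_space\<close> are treated at once.
\<close>
definition signed_convex_on :: "real \<Rightarrow> nat \<Rightarrow> real set \<Rightarrow> (real \<Rightarrow> real) \<Rightarrow> bool" where
  "signed_convex_on s p I f \<longleftrightarrow>
     (\<forall>x. strict_mono_on {..p + 1} x \<and> x ` {..p + 1} \<subseteq> I
        \<longrightarrow> 0 \<le> s * divided_difference f x (p + 1))"

lemma divided_difference_eq_sum_over_nodes:
  assumes "inj_on x {..n}"
  shows "divided_difference f x n =
    (\<Sum>u\<in>x ` {..n}. f u / (\<Prod>v\<in>x ` {..n} - {u}. u - v))"
proof -
  have "(\<Prod>v\<in>x ` {..n} - {x k}. x k - v) = (\<Prod>j\<in>{..n} - {k}. x k - x j)" if "k \<le> n" for k
  proof -
    have "x ` {..n} - {x k} = x ` ({..n} - {k})"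
      using assms that by (subst inj_on_image_set_diff[of x "{..n}"]) auto
    then show ?thesis
      using inj_on_subset[OF assms, of "{..n} - {k}"] by (simp add: prod.reindex)
  qed
  then show ?thesis
    by (simp add: divided_difference_def sum.reindex[OF assms])
qed

text \<open>
  A divided difference depends only on the set of nodes, so their increasing enumeration, as
  demanded by the definition of convexity, need never be made explicit.  This lets an extra
  node be inserted without asking where it falls.
\<close>
lemma signed_convex_on_finite_set:
  assumes "signed_convex_on s p I f" "finite S" "card S = p + 2" "S \<subseteq> I"
  shows "0 \<le> s * (\<Sum>u\<in>S. f u / (\<Prod>v\<in>S - {u}. u - v))"
proof -
  define x where "x k = sorted_list_of_set S ! k" for k
  have len: "length (sorted_list_of_set S) = p + 2"
    using assms by simp
  have mono: "strict_mono_on {..p + 1} x"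
    using sorted_wrt_nth_less[OF strict_sorted_list_of_set[of S]] len
    by (intro strict_mono_onI) (simp add: x_def)
  have "{..p + 1} = {..<p + 2}" by auto
  then have img: "x ` {..p + 1} = S"
    using assms(2) len unfolding x_def
    by (metis atLeast0LessThan list.set_map map_nth set_sorted_list_of_set set_upt)
  show ?thesis
    using assms(1,4) mono img
      divided_difference_eq_sum_over_nodes[OF strict_mono_on_imp_inj_on[OF mono], of f]
    unfolding signed_convex_on_def by metis
qed

text \<open>
  If \<open>a + r\<close> is not a node, the remainder is the divided difference at the \<open>p + 2\<close> points
  \<open>a, \<dots>, a + p, a + r\<close> times the product of the distances to the nodes.  The square of that
  product is nonnegative, and this gives the stated inequality.
\<close>
lemma newton_remainder_sign:
  assumes f: "signed_convex_on s p {c..} f" and a: "c \<le> a" "c \<le> a + r"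
  shows "0 \<le> s * newton_remainder p f a r * (\<Prod>k\<le>p. r - real k)"
proof (cases "r \<in> real ` {..p}")
  case True
  then show ?thesis by (auto simp: newton_remainder_node)
next
  case False
  define P where "P = (\<Prod>k\<le>p. r - real k)"
  have P: "P \<noteq> 0" using False by (auto simp: P_def)
  define T where "T = (\<lambda>i. a + real i) ` {..p}"
  have inj: "inj_on (\<lambda>i. a + real i) A" for A by (auto simp: inj_on_def)
  have T: "finite T" "card T = p + 1"
    using card_image[OF inj, of "{..p}"] by (auto simp: T_def)
  have rT: "a + r \<notin> T" using False by (auto simp: T_def)
  have term_i: "(\<Prod>v\<in>insert (a + r) T - {a + real i}. a + real i - v) =
      (real i - r) * node_prod p i (real i)" if "i \<le> p" for i
  proof -
    have "insert (a + r) T - {a + real i} = insert (a + r) ((\<lambda>i. a + real i) ` ({..p} - {i}))"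
      using that False by (auto simp: T_def)
    moreover have "a + r \<notin> (\<lambda>i. a + real i) ` ({..p} - {i})"
      using False by auto
    ultimately show ?thesis
      by (simp add: prod.reindex[OF inj] node_prod_def)
  qed
  have PW: "P = (r - real i) * node_prod p i r" if "i \<le> p" for i
    using that unfolding P_def node_prod_def by (subst prod.remove[of _ i]) auto
  have "(\<Sum>u\<in>insert (a + r) T. f u / (\<Prod>v\<in>insert (a + r) T - {u}. u - v)) * P =
      f (a + r) / (\<Prod>v\<in>T. a + r - v) * P
      + (\<Sum>i\<le>p. f (a + real i) / ((real i - r) * node_prod p i (real i)) * P)"
  proof -
    have "(\<Prod>v\<in>insert (a + r) T - {a + r}. a + r - v) = (\<Prod>v\<in>T. a + r - v)"
      using rT by simp
    moreover have "(\<Sum>u\<in>T. f u / (\<Prod>v\<in>insert (a + r) T - {u}. u - v)) =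
        (\<Sum>i\<le>p. f (a + real i) / ((real i - r) * node_prod p i (real i)))"
      unfolding T_def sum.reindex[OF inj]
      by (intro sum.cong) (simp_all add: term_i T_def[symmetric])
    ultimately show ?thesis
      using T rT by (simp add: algebra_simps sum_distrib_left)
  qed
  also have "(\<Prod>v\<in>T. a + r - v) = P"
    by (simp add: T_def prod.reindex[OF inj] P_def)
  also have "(\<Sum>i\<le>p. f (a + real i) / ((real i - r) * node_prod p i (real i)) * P) =
      - (\<Sum>i\<le>p. f (a + real i) * (node_prod p i r / node_prod p i (real i)))"
    unfolding sum_negf[symmetric]
  proof (intro sum.cong refl)
    fix i assume "i \<in> {..p}"
    then have "r - real i \<noteq> 0" "real i - r \<noteq> 0" "node_prod p i (real i) \<noteq> 0" "i \<le> p"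
      using False by (auto simp: node_prod_self)
    then show "f (a + real i) / ((real i - r) * node_prod p i (real i)) * P =
        - (f (a + real i) * (node_prod p i r / node_prod p i (real i)))"
      unfolding PW[OF \<open>i \<le> p\<close>] by (simp add: divide_simps) (simp add: algebra_simps)
  qed
  finally have "(\<Sum>u\<in>insert (a + r) T. f u / (\<Prod>v\<in>insert (a + r) T - {u}. u - v)) * P =
      newton_remainder p f a r"
    using P by (simp add: newton_remainder_def newton_eq_lagrange)
  moreover have "0 \<le> s * (\<Sum>u\<in>insert (a + r) T. f u / (\<Prod>v\<in>insert (a + r) T - {u}. u - v))"
    using T rT a by (intro signed_convex_on_finite_set[OF f]) (auto simp: T_def)
  then have "0 \<le> s * (\<Sum>u\<in>insert (a + r) T. f u / (\<Prod>v\<in>insert (a + r) T - {u}. u - v)) * (P * P)"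
    by (rule mult_nonneg_nonneg) simp
  ultimately show ?thesis
    unfolding P_def[symmetric] by (metis mult.assoc)
qed

text \<open>
  The interpolants at \<open>a, \<dots>, a + p\<close> and at \<open>a + 1, \<dots>, a + p + 1\<close> agree at the \<open>p\<close> common nodes,
  so they differ by a multiple of the polynomial vanishing there.
\<close>
lemma newton_remainder_shift:
  "newton_remainder p f a r = newton_remainder p f (a + 1) (r - 1)
     + ((r - 1) gchoose p) * (fdiff ^^ Suc p) f a"
proof -
  have "(\<Sum>j\<le>p. ((r - 1) gchoose j) * (fdiff ^^ j) f (a + 1)) =
      (\<Sum>j\<le>p. (r gchoose j) * (fdiff ^^ j) f a) + ((r - 1) gchoose p) * (fdiff ^^ Suc p) f a"
  proof (induction p)
    case 0
    show ?case by (simp add: fdiff_def)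
  next
    case (Suc p)
    have "r gchoose Suc p = ((r - 1) gchoose p) + ((r - 1) gchoose Suc p)"
      using gbinomial_Suc_Suc[of "r - 1" p] by simp
    moreover have "(fdiff ^^ Suc p) f (a + 1) = (fdiff ^^ Suc p) f a + (fdiff ^^ Suc (Suc p)) f a"
      using fdiff_funpow_Suc[of "Suc p" f a] by simp
    ultimately show ?case
      unfolding sum.atMost_Suc Suc.IH by (simp add: algebra_simps del: funpow.simps)
  qed
  then show ?thesis by (simp add: newton_remainder_def del: funpow.simps)
qed

text \<open>
  For \<open>0 < t < 1\<close> the point \<open>a + t\<close> lies right of exactly one of the nodes \<open>a, \<dots>, a + p\<close> and right
  of none of the nodes \<open>a + 1, \<dots>, a + p + 1\<close>.  So the two remainders there have opposite signs,
  and each is at most as large as their difference.  The preceding lemma computes this difference,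
  and its binomial factor is at most one in absolute value.
\<close>
lemma newton_remainder_bound:
  assumes f: "signed_convex_on s p {c..} f" and s: "\<bar>s\<bar> = 1" and a: "c \<le> a"
    and t: "0 \<le> t" "t \<le> 1"
  shows "\<bar>newton_remainder p f a t\<bar> \<le> s * (fdiff ^^ Suc p) f a"
proof -
  define D where "D = s * (fdiff ^^ Suc p) f a"
  define B where "B t = (-1) ^ p * ((t - 1) gchoose p)" for t :: real
  \<comment> \<open>The sign of the product of distances gives no information where it vanishes, that is,
    where \<open>t\<close> is itself a node; there the remainder is zero.\<close>
  have right: "0 \<le> s * (-1) ^ p * newton_remainder p f a t"
  proof (cases "t = 0 \<or> t = 1 \<and> 0 < p")
    case True
    then show ?thesis
      using newton_remainder_node[of 0 p f a] newton_remainder_node[of 1 p f a] by auto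
  next
    case False
    have "(\<Prod>k\<le>p. t - real k) = t * (\<Prod>k=1..p. - (real k - t))"
      by (simp add: prod.atMost_shift atLeast0AtMost[symmetric] prod.atLeast_Suc_atMost)
    also have "\<dots> = (-1) ^ p * (t * (\<Prod>k=1..p. real k - t))"
      by (subst prod_uminus) simp
    finally have P: "(\<Prod>k\<le>p. t - real k) = (-1) ^ p * (t * (\<Prod>k=1..p. real k - t))" .
    have pos: "0 < t * (\<Prod>k=1..p. real k - t)"
      using False t by (intro mult_pos_pos prod_pos) auto
    have "0 \<le> (s * (-1) ^ p * newton_remainder p f a t) * (t * (\<Prod>k=1..p. real k - t))"
      using newton_remainder_sign[OF f a, of t] a t unfolding P by (simp add: mult_ac)
    then show ?thesis using pos by (simp add: zero_le_mult_iff)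
  qed
  have left: "0 \<le> - (s * (-1) ^ p * newton_remainder p f (a + 1) (t - 1))" if "0 \<le> t" "t \<le> 1" for t
  proof (cases "t = 1")
    case True
    then show ?thesis using newton_remainder_node[of 0 p f "a + 1"] by simp
  next
    case False
    have "(\<Prod>k\<le>p. t - 1 - real k) = (\<Prod>k\<le>p. - (real k + 1 - t))"
      by (simp add: algebra_simps)
    also have "\<dots> = (-1) ^ Suc p * (\<Prod>k\<le>p. real k + 1 - t)"
      by (subst prod_uminus) simp
    finally have P: "(\<Prod>k\<le>p. t - 1 - real k) = (-1) ^ Suc p * (\<Prod>k\<le>p. real k + 1 - t)" .
    have pos: "0 < (\<Prod>k\<le>p. real k + 1 - t)"
      using False that by (intro prod_pos) auto
    have "0 \<le> - (s * (-1) ^ p * newton_remainder p f (a + 1) (t - 1)) * (\<Prod>k\<le>p. real k + 1 - t)"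
      using newton_remainder_sign[OF f, of "a + 1" "t - 1"] a that unfolding P by (simp add: mult_ac)
    then show ?thesis using pos by (simp add: zero_le_mult_iff mult_le_0_iff)
  qed
  \<comment> \<open>At \<open>t = 0\<close> the remainder for the first set of nodes is zero, so \<open>D\<close> is minus the (signed)
    remainder for the second set.\<close>
  have D: "0 \<le> D"
  proof -
    have "((-1::real) gchoose p) = (-1) ^ p"
      using gbinomial_minus[of "1::real" p] by (simp add: binomial_gbinomial[symmetric])
    then have "newton_remainder p f (a + 1) (- 1) = - ((-1) ^ p * (fdiff ^^ Suc p) f a)"
      using newton_remainder_shift[of p f a 0] newton_remainder_node[of 0 p f a]
      by (simp del: funpow.simps)
    then have "D = - (s * (-1) ^ p * newton_remainder p f (a + 1) (0 - 1))"
      by (simp add: D_def power_mult_distrib[symmetric] mult.assoc[symmetric]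
          minus_one_power_iff del: funpow.simps)
    then show ?thesis using left[of 0] by simp
  qed
  have B: "B t \<le> 1"
  proof -
    have "fact p * B t = (-1) ^ p * (\<Prod>k=0..<p. t - 1 - real k)"
      by (simp add: B_def gbinomial_mult_fact[symmetric])
    also have "\<dots> = (\<Prod>k=0..<p. - (t - 1 - real k))"
      by (subst prod_uminus) simp
    also have "\<dots> \<le> (\<Prod>k=0..<p. real (Suc k))"
      using t by (intro prod_mono) auto
    also have "\<dots> = fact p"
      by (simp add: fact_prod_Suc)
    finally show ?thesis by simp
  qed
  have "s * (-1) ^ p * newton_remainder p f a t =
      s * (-1) ^ p * newton_remainder p f (a + 1) (t - 1) + B t * D"
    by (subst newton_remainder_shift) (simp add: B_def D_def algebra_simps del: funpow.simps)
  also have "\<dots> \<le> 1 * D"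
    using left[OF t] mult_right_mono[OF B D] by linarith
  finally have "\<bar>s * (-1) ^ p * newton_remainder p f a t\<bar> \<le> D"
    using right by simp
  then show ?thesis
    by (simp add: abs_mult s D_def del: funpow.simps)
qed

section \<open>Uniform convergence to the principal indefinite sum\<close>

lemma K_space_signed:
  assumes "g \<in> K_space p"
  obtains s c where "\<bar>s\<bar> = 1" "c > 0" "signed_convex_on s p {c..} g"
proof -
  from assms obtain c where c: "c > 0" "p_convex_on p {c..} g \<or> p_concave_on p {c..} g"
    by (auto simp: K_space_def)
  from c(2) show thesis
  proof
    assume "p_convex_on p {c..} g"
    then show thesis
      using that[of 1 c] c(1) by (simp add: p_convex_on_def signed_convex_on_def)
  next
    assume "p_concave_on p {c..} g"
    then show thesis
      using that[of "-1" c] c(1) by (simp add: p_concave_on_def signed_convex_on_def)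
  qed
qed

lemma continuous_on_gchoose: "continuous_on A (\<lambda>t::real. t gchoose j)"
  unfolding gbinomial_prod_rev by (intro continuous_intros) auto

text \<open>
  This is \<open>Sigma_seq p g t n + g t\<close>, an approximation of \<open>Sigma_op g (t + 1)\<close> for \<open>t > 0\<close>.  The term
  \<open>g t\<close> has been cancelled so that the function is continuous on the closed unit interval although
  nothing is known about \<open>g\<close> near zero.
\<close>
definition shifted_Sigma_seq :: "nat \<Rightarrow> (real \<Rightarrow> real) \<Rightarrow> nat \<Rightarrow> real \<Rightarrow> real" where
  "shifted_Sigma_seq p g n t =
     (\<Sum>k=1..<n. g (real k) - g (t + real k)) + (\<Sum>j=1..p. (t gchoose j) * (fdiff ^^ (j - 1)) g (real n))"

text \<open>
  Passing from \<open>n\<close> to \<open>n + 1\<close> raises the order of every difference in the Newton sum by one, which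
  completes \<open>g (n + t) - g n\<close> to the interpolation error.
\<close>
lemma shifted_Sigma_seq_Suc:
  assumes "n \<ge> 1"
  shows "shifted_Sigma_seq p g (Suc n) t = shifted_Sigma_seq p g n t - newton_remainder p g (real n) t"
proof -
  have "(\<Sum>j=1..p. (t gchoose j) * (fdiff ^^ (j - 1)) g (real (Suc n))) =
      (\<Sum>j=1..p. (t gchoose j) * (fdiff ^^ (j - 1)) g (real n))
      + (\<Sum>j\<le>p. (t gchoose j) * (fdiff ^^ j) g (real n)) - g (real n)"
  proof (induction p)
    case (Suc p)
    have "(fdiff ^^ p) g (real (Suc n)) = (fdiff ^^ p) g (real n) + (fdiff ^^ Suc p) g (real n)"
      using fdiff_funpow_Suc[of p g "real n"] by (simp add: add.commute)
    then show ?case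
      using Suc.IH by (simp add: algebra_simps del: funpow.simps)
  qed simp
  then show ?thesis
    using assms by (simp add: shifted_Sigma_seq_def newton_remainder_def add.commute)
qed

text \<open>
  Pascal's rule for \<open>(t + 1) gchoose j\<close> produces a second Newton sum, which together with the
  displaced term \<open>g (n + t)\<close> is again an interpolation error, short of its term of order \<open>p\<close>.
\<close>
lemma Sigma_seq_add_1:
  assumes "n \<ge> 1"
  shows "Sigma_seq p g (t + 1) n =
    shifted_Sigma_seq p g n t - newton_remainder p g (real n) t - (t gchoose p) * (fdiff ^^ p) g (real n)"
proof -
  have 1: "(\<Sum>k=1..<n. g (t + 1 + real k)) = (\<Sum>k=1..<n. g (t + real k)) + g (t + real n) - g (t + 1)"
    using assms by (induction n rule: dec_induct) (simp_all add: add.commute add.left_commute)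
  have 2: "(\<Sum>j=1..p. ((t + 1) gchoose j) * (fdiff ^^ (j - 1)) g (real n)) =
      (\<Sum>j=1..p. (t gchoose j) * (fdiff ^^ (j - 1)) g (real n))
      + (\<Sum>j\<le>p. (t gchoose j) * (fdiff ^^ j) g (real n)) - (t gchoose p) * (fdiff ^^ p) g (real n)"
  proof (induction p)
    case (Suc p)
    then show ?case
      using gbinomial_Suc_Suc[of t p] by (simp add: algebra_simps del: funpow.simps)
  qed simp
  show ?thesis
    using 1 2
    by (simp add: Sigma_seq_def shifted_Sigma_seq_def newton_remainder_def sum_subtractf add.commute)
qed

text \<open>
  The increments are dominated, uniformly on the unit interval, by those of the null sequence
  \<open>s * (fdiff ^^ p) g n\<close>, so the sequence is uniformly Cauchy.  Its limit is \<open>Sigma_op g (t + 1)\<close>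
  because the two correction terms of the preceding lemma vanish in the limit.
\<close>
lemma uniform_limit_shifted_Sigma_seq:
  assumes g: "g \<in> D_space p \<inter> K_space p"
  shows "uniform_limit {0..1} (shifted_Sigma_seq p g) (\<lambda>t. Sigma_op g (t + 1)) sequentially"
proof -
  from g have "g \<in> K_space p" by simp
  then obtain s c where s: "\<bar>s\<bar> = 1" and f: "signed_convex_on s p {c..} g"
    by (rule K_space_signed) blast
  define d where "d n = s * (fdiff ^^ p) g (real n)" for n
  have d0: "d \<longlonglongrightarrow> 0"
    using g tendsto_mult_right_zero[of "\<lambda>n. (fdiff ^^ p) g (real n)" sequentially s]
    by (simp add: d_def[abs_def] D_space_def)
  define N where "N = nat \<lceil>max c 1\<rceil>"
  have N: "real n \<ge> c \<and> n \<ge> 1" if "n \<ge> N" for n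
    using that unfolding N_def by linarith
  have bound: "\<bar>newton_remainder p g (real n) t\<bar> \<le> d (Suc n) - d n"
    if "n \<ge> N" "t \<in> {0..1}" for n t
  proof -
    have "s * (fdiff ^^ Suc p) g (real n) = d (Suc n) - d n"
      unfolding d_def fdiff_funpow_Suc by (simp add: algebra_simps)
    then show ?thesis
      using newton_remainder_bound[OF f s, of "real n" t] N[OF that(1)] that(2) by simp
  qed
  have tele: "\<bar>shifted_Sigma_seq p g m t - shifted_Sigma_seq p g n t\<bar> \<le> d m - d n"
    if "N \<le> n" "n \<le> m" "t \<in> {0..1}" for m n t
    using that(2)
  proof (induction m rule: dec_induct)
    case base
    show ?case by simp
  next
    case (step m)
    then have m: "m \<ge> N" using that by simp
    show ?case
      using step.IH bound[OF m that(3)] N[OF m] by (simp add: shifted_Sigma_seq_Suc)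
  qed
  have "uniformly_Cauchy_on {0..1} (shifted_Sigma_seq p g)"
  proof (rule uniformly_Cauchy_onI')
    fix e :: real assume "e > 0"
    then obtain M where M: "\<And>m n. m \<ge> M \<Longrightarrow> n \<ge> M \<Longrightarrow> \<bar>d m - d n\<bar> < e"
      using LIMSEQ_imp_Cauchy[OF d0] unfolding Cauchy_def dist_real_def by blast
    show "\<exists>M. \<forall>t\<in>{0..1}. \<forall>m\<ge>M. \<forall>n>m.
        dist (shifted_Sigma_seq p g m t) (shifted_Sigma_seq p g n t) < e"
    proof (intro exI ballI allI impI)
      fix t :: real and m n assume t: "t \<in> {0..1}" and mn: "max M N \<le> m" "m < n"
      have "\<bar>shifted_Sigma_seq p g n t - shifted_Sigma_seq p g m t\<bar> \<le> d n - d m"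
        using mn t by (intro tele) auto
      also have "\<dots> < e" using M[of n m] mn by auto
      finally show "dist (shifted_Sigma_seq p g m t) (shifted_Sigma_seq p g n t) < e"
        by (simp add: dist_real_def abs_minus_commute)
    qed
  qed
  then have "uniformly_convergent_on {0..1} (shifted_Sigma_seq p g)"
    by (rule Cauchy_uniformly_convergent)
  then have lim: "uniform_limit {0..1} (shifted_Sigma_seq p g)
      (\<lambda>t. lim (\<lambda>n. shifted_Sigma_seq p g n t)) sequentially"
    by (simp add: uniformly_convergent_uniform_limit_iff)
  have "lim (\<lambda>n. shifted_Sigma_seq p g n t) = Sigma_op g (t + 1)" if t: "t \<in> {0..1}" for t
  proof -
    have "(\<lambda>n. newton_remainder p g (real n) t) \<longlonglongrightarrow> 0"
    proof (rule Lim_null_comparison)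
      show "\<forall>\<^sub>F n in sequentially. norm (newton_remainder p g (real n) t) \<le> d (Suc n) - d n"
        using bound t by (intro eventually_sequentiallyI[of N]) simp
      show "(\<lambda>n. d (Suc n) - d n) \<longlonglongrightarrow> 0"
        using tendsto_diff[OF LIMSEQ_Suc[OF d0] d0] by simp
    qed
    moreover have "(\<lambda>n. (t gchoose p) * (fdiff ^^ p) g (real n)) \<longlonglongrightarrow> 0"
      using g by (intro tendsto_mult_right_zero) (simp add: D_space_def)
    ultimately have "(\<lambda>n. newton_remainder p g (real n) t + (t gchoose p) * (fdiff ^^ p) g (real n)) \<longlonglongrightarrow> 0"
      using tendsto_add by fastforce
    moreover have "\<forall>\<^sub>F n in sequentially.
        newton_remainder p g (real n) t + (t gchoose p) * (fdiff ^^ p) g (real n) =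
        shifted_Sigma_seq p g n t - Sigma_seq p g (t + 1) n"
      by (intro eventually_sequentiallyI[of 1]) (simp add: Sigma_seq_add_1)
    ultimately have "(\<lambda>n. shifted_Sigma_seq p g n t - Sigma_seq p g (t + 1) n) \<longlonglongrightarrow> 0"
      by (rule Lim_transform_eventually)
    then show ?thesis
      unfolding Sigma_eq[OF g] by (rule lim_eq_if_diff_tendsto_0)
  qed
  with lim show ?thesis
    by (subst uniform_limit_cong'[where g="shifted_Sigma_seq p g" and i="\<lambda>t. lim (\<lambda>n. shifted_Sigma_seq p g n t)"]) auto
qed

section \<open>The generalized Stirling formula at the integers\<close>

lemma has_integral_shift_unit:
  fixes g :: "real \<Rightarrow> real"
  assumes "continuous_on {0<..} g" "0 < a"
  shows "((\<lambda>t. g (t + a)) has_integral integral {a..a + 1} g) {0..1}"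
proof -
  have "(g has_integral integral {a..a + 1} g) (cbox a (a + 1))"
    using assms by (auto intro!: integrable_integral integrable_continuous_real
      continuous_on_subset[OF assms(1)] simp: cbox_interval)
  from has_integral_affinity'[OF this, of 1 a] show ?thesis
    by (simp add: cbox_interval)
qed

lemma sum_integral_unit_intervals:
  fixes g :: "real \<Rightarrow> real"
  assumes "continuous_on {0<..} g" "1 \<le> n"
  shows "(\<Sum>k=1..<n. integral {real k..real k + 1} g) = integral {1..real n} g"
  using assms(2)
proof (induction n rule: dec_induct)
  case (step n)
  have "g integrable_on {1..real n + 1}"
    by (auto intro!: integrable_continuous_real continuous_on_subset[OF assms(1)])
  from Henstock_Kurzweil_Integration.integral_combine[OF _ _ this, of "real n"] step
  show ?case by (simp add: add.commute)
qed simp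

lemma has_integral_shifted_Sigma_seq:
  assumes g: "continuous_on {0<..} g" and n: "n \<ge> 1"
  shows "(shifted_Sigma_seq p g n has_integral
     ((\<Sum>k=1..<n. g (real k)) - integral {1..real n} g
       + (\<Sum>j=1..p. gregory_coeff j * (fdiff ^^ (j - 1)) g (real n)))) {0..1}"
proof -
  have "((\<lambda>t. g (real k) - g (t + real k)) has_integral
      (g (real k) - integral {real k..real k + 1} g)) {0..1}" if "k \<in> {1..<n}" for k
  proof (rule has_integral_diff)
    show "((\<lambda>t. g (real k)) has_integral g (real k)) {0..1::real}"
      using has_integral_const_real[of "g (real k)" 0 1] by simp
    show "((\<lambda>t. g (t + real k)) has_integral integral {real k..real k + 1} g) {0..1}"
      using that by (intro has_integral_shift_unit g) auto
  qed
  then have 1: "((\<lambda>t. \<Sum>k=1..<n. g (real k) - g (t + real k)) has_integral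
      (\<Sum>k=1..<n. g (real k) - integral {real k..real k + 1} g)) {0..1}"
    by (intro has_integral_sum) auto
  have "((\<lambda>t. (t gchoose j) * (fdiff ^^ (j - 1)) g (real n)) has_integral
      gregory_coeff j * (fdiff ^^ (j - 1)) g (real n)) {0..1}" for j
    unfolding gregory_coeff_def
    by (intro has_integral_mult_left integrable_integral integrable_continuous_real
        continuous_on_gchoose)
  then have 2: "((\<lambda>t. \<Sum>j=1..p. (t gchoose j) * (fdiff ^^ (j - 1)) g (real n)) has_integral
      (\<Sum>j=1..p. gregory_coeff j * (fdiff ^^ (j - 1)) g (real n))) {0..1}"
    by (intro has_integral_sum) auto
  show ?thesis
    using has_integral_add[OF 1 2] sum_integral_unit_intervals[OF g n]
    by (simp add: shifted_Sigma_seq_def[abs_def] sum_subtractf)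
qed

text \<open>
  The sequence is the integral of \<open>shifted_Sigma_seq\<close> over the unit interval: the translates
  \<open>g (t + k)\<close> sweep out the interval from \<open>1\<close> to \<open>n\<close>, and the binomial coefficients integrate to the
  Gregory coefficients.  Uniform convergence carries the limit through the integral.
\<close>
lemma generalized_stirling:
  assumes g: "g \<in> C0_space \<inter> D_space p \<inter> K_space p"
  shows "(\<lambda>n. (\<Sum>k=1..<n. g (real k)) - integral {1..real n} g
       + (\<Sum>j=1..p. gregory_coeff j * (fdiff ^^ (j - 1)) g (real n))) \<longlonglongrightarrow> sigma_const g"
proof -
  have cont: "continuous_on {0<..} g" using g by (simp add: C0_space_def)
  define A where "A n = shifted_Sigma_seq p g (Suc n)" for n
  have "uniform_limit {0..1} A (\<lambda>t. Sigma_op g (t + 1)) sequentially"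
    using filterlim_compose[OF uniform_limit_shifted_Sigma_seq filterlim_Suc] g
    unfolding A_def[abs_def] by auto
  moreover have "continuous_on {0..1} (A n)" for n
    unfolding A_def shifted_Sigma_seq_def
    by (intro continuous_intros continuous_on_gchoose continuous_on_compose2[OF cont]) auto
  ultimately obtain I J where I: "\<And>n. (A n has_integral I n) {0..1}"
    and J: "((\<lambda>t. Sigma_op g (t + 1)) has_integral J) {0..1}" and IJ: "I \<longlonglongrightarrow> J"
    by (rule uniform_limit_integral) (simp, blast)
  have "I n = (\<Sum>k=1..<Suc n. g (real k)) - integral {1..real (Suc n)} g
       + (\<Sum>j=1..p. gregory_coeff j * (fdiff ^^ (j - 1)) g (real (Suc n)))" for n
    using has_integral_unique[OF I[unfolded A_def] has_integral_shifted_Sigma_seq[OF cont]] by simp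
  moreover have "J = sigma_const g"
    using J by (simp add: sigma_const_def integral_unique)
  ultimately show ?thesis
    using IJ by (subst filterlim_sequentially_Suc[symmetric]) presburger
qed

section \<open>Dilation by two\<close>

lemma fdiff_funpow_cong_pos:
  assumes "\<And>x. x > 0 \<Longrightarrow> f x = g x" "x > 0"
  shows "(fdiff ^^ j) f x = (fdiff ^^ j) g x"
  using assms(2) by (induction j arbitrary: x) (simp_all add: assms(1) fdiff_def)

lemma fdiff_funpow_add:
  "(fdiff ^^ j) (\<lambda>x. f x + g x) x = (fdiff ^^ j) f x + (fdiff ^^ j) g x"
  by (induction j arbitrary: x) (simp_all add: fdiff_def)

lemma fdiff_funpow_cmult: "(fdiff ^^ j) (\<lambda>x. c * f x) x = c * (fdiff ^^ j) f x"
  by (induction j arbitrary: x) (simp_all add: fdiff_def algebra_simps)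

lemma fdiff_funpow_translate: "(fdiff ^^ j) (\<lambda>x. f (x + c)) x = (fdiff ^^ j) f (x + c)"
  by (induction j arbitrary: x) (simp_all add: fdiff_def add_ac)

text \<open>
  A unit step for the dilated function is two unit steps for \<open>g\<close>:
  \<open>fdiff\<close> of the dilation of \<open>g\<close> is the dilation of \<open>u x = fdiff g x + fdiff g (x + 1)\<close>, and \<open>u\<close>
  inherits the hypothesis with \<open>p\<close> lowered by one.
\<close>
lemma D_space_dilate:
  assumes "g \<in> D_space p"
  shows "(\<lambda>x. g (2 * x)) \<in> D_space p"
  using assms
proof (induction p arbitrary: g)
  case 0
  then have "(\<lambda>n. g (real n)) \<longlonglongrightarrow> 0" by (simp add: D_space_def)
  from filterlim_compose[OF this filterlim_subseq[of "\<lambda>n. 2 * n"]]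
  show ?case by (simp add: D_space_def strict_mono_def)
next
  case (Suc p)
  define u where "u x = fdiff g x + fdiff g (x + 1)" for x
  have lim: "(\<lambda>n. (fdiff ^^ Suc p) g (real n)) \<longlonglongrightarrow> 0"
    using Suc.prems by (simp add: D_space_def)
  have "(fdiff ^^ p) u x = (fdiff ^^ Suc p) g x + (fdiff ^^ Suc p) g (x + 1)" for x
    unfolding u_def[abs_def] fdiff_funpow_add fdiff_funpow_translate
    by (simp only: funpow_Suc_right o_apply)
  then have "u \<in> D_space p"
    using tendsto_add[OF lim LIMSEQ_Suc[OF lim]] by (simp add: D_space_def add.commute del: funpow.simps)
  from Suc.IH[OF this] have "(\<lambda>n. (fdiff ^^ p) (\<lambda>x. u (2 * x)) (real n)) \<longlonglongrightarrow> 0"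
    by (simp add: D_space_def)
  moreover have "fdiff (\<lambda>x. g (2 * x)) = (\<lambda>x. u (2 * x))"
    by (simp add: fun_eq_iff fdiff_def u_def algebra_simps)
  ultimately show ?case
    unfolding D_space_def funpow_Suc_right by simp
qed

lemma divided_difference_dilate:
  assumes "\<And>k. k \<le> n \<Longrightarrow> h (x k) = 2 * g (2 * x k)"
  shows "divided_difference h x n = 2 ^ Suc n * divided_difference g (\<lambda>k. 2 * x k) n"
proof -
  have "h (x k) / (\<Prod>j\<in>{..n} - {k}. x k - x j) =
      2 ^ Suc n * (g (2 * x k) / (\<Prod>j\<in>{..n} - {k}. 2 * x k - 2 * x j))" if "k \<le> n" for k
  proof -
    have "(\<Prod>j\<in>{..n} - {k}. 2 * x k - 2 * x j) = (\<Prod>j\<in>{..n} - {k}. 2 * (x k - x j))"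
      by (simp only: right_diff_distrib)
    also have "\<dots> = 2 ^ n * (\<Prod>j\<in>{..n} - {k}. x k - x j)"
      using that by (subst prod.distrib) simp
    finally show ?thesis
      using that by (simp add: assms)
  qed
  then show ?thesis
    unfolding divided_difference_def sum_distrib_left by (intro sum.cong) auto
qed

lemma dilation_in_spaces:
  assumes g: "g \<in> C0_space \<inter> D_space p \<inter> K_space p"
    and h: "\<And>x. x > 0 \<Longrightarrow> h x = 2 * g (2 * x)"
  shows "h \<in> C0_space \<inter> D_space p \<inter> K_space p"
proof (intro IntI)
  have "continuous_on {0<..} (\<lambda>x. 2 * g (2 * x))"
    using g by (auto intro!: continuous_intros continuous_on_compose2[of "{0<..}" g] simp: C0_space_def)
  then have "continuous_on {0<..} h"
    by (rule continuous_on_eq) (simp add: h)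
  then show "h \<in> C0_space" by (simp add: C0_space_def)
next
  have "(\<lambda>n. (fdiff ^^ p) (\<lambda>x. g (2 * x)) (real n)) \<longlonglongrightarrow> 0"
    using D_space_dilate[of g p] g by (simp add: D_space_def)
  then have "(\<lambda>n. (fdiff ^^ p) (\<lambda>x. 2 * g (2 * x)) (real n)) \<longlonglongrightarrow> 0"
    unfolding fdiff_funpow_cmult by (rule tendsto_mult_right_zero)
  moreover have "\<forall>\<^sub>F n in sequentially.
      (fdiff ^^ p) (\<lambda>x. 2 * g (2 * x)) (real n) = (fdiff ^^ p) h (real n)"
    by (intro eventually_sequentiallyI[of 1] fdiff_funpow_cong_pos) (auto simp: h)
  ultimately show "h \<in> D_space p"
    unfolding D_space_def by (auto intro: Lim_transform_eventually)
next
  obtain c where c: "c > 0" "p_convex_on p {c..} g \<or> p_concave_on p {c..} g"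
    using g by (auto simp: K_space_def)
  have dd: "divided_difference h x (p + 1) = 2 ^ (p + 2) * divided_difference g (\<lambda>k. 2 * x k) (p + 1)"
      and mono: "strict_mono_on {..p + 1} (\<lambda>k. 2 * x k)"
      and img: "(\<lambda>k. 2 * x k) ` {..p + 1} \<subseteq> {c..}"
    if x: "strict_mono_on {..p + 1} x" "x ` {..p + 1} \<subseteq> {c..}" for x
  proof -
    have ge: "x k \<ge> c" if "k \<le> p + 1" for k using x(2) that by auto
    have "h (x k) = 2 * g (2 * x k)" if "k \<le> p + 1" for k
      using ge[OF that] c(1) by (intro h) simp
    from divided_difference_dilate[of "p + 1" h x g, OF this]
    show "divided_difference h x (p + 1) = 2 ^ (p + 2) * divided_difference g (\<lambda>k. 2 * x k) (p + 1)"
      by simp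
    show "strict_mono_on {..p + 1} (\<lambda>k. 2 * x k)"
      using x(1) by (auto simp: strict_mono_on_def)
    show "(\<lambda>k. 2 * x k) ` {..p + 1} \<subseteq> {c..}"
      using ge c(1) by fastforce
  qed
  from c(2) have "p_convex_on p {c..} h \<or> p_concave_on p {c..} h"
  proof
    assume "p_convex_on p {c..} g"
    then have "p_convex_on p {c..} h"
      unfolding p_convex_on_def using dd mono img by (metis zero_le_mult_iff zero_le_power zero_le_numeral)
    then show ?thesis ..
  next
    assume "p_concave_on p {c..} g"
    then have "p_concave_on p {c..} h"
      unfolding p_concave_on_def using dd mono img by (metis mult_nonneg_nonpos zero_le_power zero_le_numeral)
    then show ?thesis ..
  qed
  then show "h \<in> K_space p" using c(1) by (auto simp: K_space_def)
qed

section \<open>The alternating sum\<close>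

lemma integral_dilate:
  fixes g h :: "real \<Rightarrow> real"
  assumes g: "continuous_on {0<..} g" and h: "\<And>x. x > 0 \<Longrightarrow> h x = 2 * g (2 * x)" and b: "1 \<le> b"
  shows "integral {1..b} h = integral {2..2 * b} g"
proof -
  have "(g has_integral integral {2..2 * b} g) (cbox 2 (2 * b))"
    by (auto intro!: integrable_integral integrable_continuous_real
      continuous_on_subset[OF g] simp: cbox_interval)
  from has_integral_mult_right[OF has_integral_affinity'[OF this, of 2 0], of 2]
  have "((\<lambda>x. 2 * g (2 * x)) has_integral integral {2..2 * b} g) {1..b}"
    by (simp add: cbox_interval)
  then have "(h has_integral integral {2..2 * b} g) {1..b}"
    by (rule has_integral_eq[rotated]) (simp add: h)
  then show ?thesis by (rule integral_unique)
qed

lemma alternating_sum_eq: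
  fixes g h :: "real \<Rightarrow> real"
  assumes h: "\<And>x. x > 0 \<Longrightarrow> h x = 2 * g (2 * x)"
  shows "(\<Sum>k=1..2 * n. (-1) ^ (k - 1) * g (real k)) =
    (\<Sum>k=1..<2 * n + 1. g (real k)) - (\<Sum>k=1..<n + 1. h (real k))"
proof (induction n)
  case (Suc n)
  have "h (real (Suc n)) = 2 * g (real (2 * n + 2))" by (subst h) (simp_all add: algebra_simps)
  with Suc show ?case by (simp add: algebra_simps)
qed simp

text \<open>
  Both sides are the integral over the last unit window minus the one over the first.
  The right-hand side has the form in which the two integrals arise from the Stirling
  formulas for \<open>g\<close> and for its dilation.
\<close>
lemma integral_window_difference:
  fixes g :: "real \<Rightarrow> real"
  assumes g: "continuous_on {0<..} g" and m: "0 \<le> m"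
  shows "integral {1..2} (\<lambda>t. g (m + t) - g t) =
     integral {2..m + 2} g - integral {1..m + 1} g"
proof -
  have int: "g integrable_on {a..b}" if "0 < a" for a b
    using that by (auto intro!: integrable_continuous_real continuous_on_subset[OF g])
  have "(g has_integral integral {m + 1..m + 2} g) (cbox (m + 1) (m + 2))"
    using int[of "m + 1" "m + 2"] m by (simp add: cbox_interval integrable_integral)
  from has_integral_affinity'[OF this, of 1 m]
  have "((\<lambda>t. g (m + t)) has_integral integral {m + 1..m + 2} g) {1..2}"
    by (simp add: cbox_interval add.commute)
  from has_integral_diff[OF this integrable_integral[OF int[of 1 2]]]
  have "integral {1..2} (\<lambda>t. g (m + t) - g t) = integral {m + 1..m + 2} g - integral {1..2} g"
    by (simp add: integral_unique)
  moreover have "integral {1..m + 1} g + integral {m + 1..m + 2} g = integral {1..m + 2} g"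
    using m int by (intro Henstock_Kurzweil_Integration.integral_combine) auto
  moreover have "integral {1..2} g + integral {2..m + 2} g = integral {1..m + 2} g"
    using m int by (intro Henstock_Kurzweil_Integration.integral_combine) auto
  ultimately show ?thesis by linarith
qed

theorem proposition8p49:
  fixes g g' :: "real \<Rightarrow> real" and h :: "nat \<Rightarrow> real" and p :: nat
  assumes g: "g \<in> C0_space \<inter> D_space p \<inter> K_space p"
    and g': "\<And>x. x > 0 \<Longrightarrow> g' x = 2 * g (2 * x)"
    and h: "\<And>n. n \<ge> 1 \<Longrightarrow>
      h n = sigma_const g' - sigma_const g
            + integral {1..2} (\<lambda>t. g (2 * real n + t) - g t)
            + (\<Sum>j=1..p. gregory_coeff j *
                 ((fdiff ^^ (j - 1)) g (2 * real n + 1) - (fdiff ^^ (j - 1)) g' (real n + 1)))"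
  shows "(\<lambda>n. h n + (\<Sum>k=1..2*n. (-1) ^ (k - 1) * g (real k))) \<longlonglongrightarrow> 0"
proof -
  define S where "S f m = (\<Sum>k=1..<m. f (real k)) - integral {1..real m} f
       + (\<Sum>j=1..p. gregory_coeff j * (fdiff ^^ (j - 1)) f (real m))" for f and m :: nat
  have cont: "continuous_on {0<..} g" using g by (simp add: C0_space_def)
  have "S g \<longlonglongrightarrow> sigma_const g" "S g' \<longlonglongrightarrow> sigma_const g'"
    unfolding S_def[abs_def] using generalized_stirling[OF g] generalized_stirling[OF dilation_in_spaces[OF g g']]
    by simp_all
  then have "(\<lambda>n. S g (2 * n + 1)) \<longlonglongrightarrow> sigma_const g" "(\<lambda>n. S g' (n + 1)) \<longlonglongrightarrow> sigma_const g'"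
    by (auto intro: filterlim_compose[OF _ filterlim_subseq] simp: strict_mono_def)
  then have "(\<lambda>n. (sigma_const g' - sigma_const g) + (S g (2 * n + 1) - S g' (n + 1))) \<longlonglongrightarrow>
      (sigma_const g' - sigma_const g) + (sigma_const g - sigma_const g')"
    by (intro tendsto_intros)
  then have "(\<lambda>n. (sigma_const g' - sigma_const g) + (S g (2 * n + 1) - S g' (n + 1))) \<longlonglongrightarrow> 0"
    by simp
  moreover have "\<forall>\<^sub>F n in sequentially.
      (sigma_const g' - sigma_const g) + (S g (2 * n + 1) - S g' (n + 1)) =
      h n + (\<Sum>k=1..2*n. (-1) ^ (k - 1) * g (real k))"
  proof (rule eventually_sequentiallyI[of 1])
    fix n :: nat assume n: "1 \<le> n"
    have "integral {1..2} (\<lambda>t. g (2 * real n + t) - g t) =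
        integral {1..real (n + 1)} g' - integral {1..real (2 * n + 1)} g"
      using integral_window_difference[OF cont, of "2 * real n"] integral_dilate[OF cont g', of "real (n + 1)"]
      by (simp add: add.commute)
    moreover have "(\<Sum>j=1..p. gregory_coeff j *
        ((fdiff ^^ (j - 1)) g (2 * real n + 1) - (fdiff ^^ (j - 1)) g' (real n + 1))) =
      (\<Sum>j=1..p. gregory_coeff j * (fdiff ^^ (j - 1)) g (real (2 * n + 1)))
      - (\<Sum>j=1..p. gregory_coeff j * (fdiff ^^ (j - 1)) g' (real (n + 1)))"
      by (simp add: sum_subtractf[symmetric] right_diff_distrib add.commute)
    ultimately show "(sigma_const g' - sigma_const g) + (S g (2 * n + 1) - S g' (n + 1)) =
      h n + (\<Sum>k=1..2*n. (-1) ^ (k - 1) * g (real k))"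
      using h[OF n] alternating_sum_eq[of g' g n, OF g'] unfolding S_def by linarith
  qed
  ultimately show ?thesis
    by (rule Lim_transform_eventually)
qed

end
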